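(* Fix any request sequence. In each phase $P$ of Bucketing, the expected number of fetches satisfies $$\mathbb{E}[C+S]\le H_{\min\{k,\ell\}}\cdot \mathbb{E}[C],$$ where $C$ and $S$ are the numbers of clean and stale fetches during $P$ (the paper notes that $C$ does not depend on the random choices, so the bound reads $H_{\min\{k,\ell\}}\cdot C$).
   Context: Model: universe $\mathcal{U}$, DAG $G$, $T(x)$ = set of items reachable from $x$ in $G$ including $x$, each item has at most $k-1$ dependencies; a cache of at most $k$ items is feasible if it contains $T(x)$ for every cached $x$; on a request to $v$ the algorithm must make $T(v)$ cached via single fetches/evictions keeping feasibility; cost = number of fetches. $\tau$ is a fixed total order on $\mathcal{U}$ with $v<_\tau u$ whenever $v\in T(u)$, $v\ne u$. $\ell$: take the transitive closure of $G$, then its symmetric closure; $\ell$ is the size of a maximum independent set of the resulting undirected graph. $H_j=\sum_{i=1}^j1/i$. Algorithm Bucketing: maintains a pool $\Gamma$ of subsets ("buckets"). A set in $\Gamma$ is frozen if it is empty or if evicting its $\tau$-maximum element would make the cache infeasible; frozen sets are removed from $\Gamma$ immediately ("discard frozen sets"). ResetBuckets sets $\Gamma:=\{T(x): x$ cached and no other cached $y$ has $x\in T(y)\}$. Initially $\Gamma:=$ResetBuckets. On request $v$: for each $w\in T(v)$ in increasing $\tau$: (i) remove items of $T(v)$ from all sets of $\Gamma$, discard frozen sets; (ii) if $\Gamma=\emptyset$, set $\Gamma:=$ResetBuckets, then remove items of $T(v)$ from all sets and discard frozen sets; (iii) if $w$ is uncached: if the cache is full, choose $B\in\Gamma$ uniformly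 at random, let $y$ be its $\tau$-maximum item, remove $y$ from all sets, discard frozen sets, evict $y$; then fetch $w$. Then serve $v$. Phases: the pseudo-request sequence replaces each request $v$ by the items of $T(v)$ in increasing $\tau$ (one per loop iteration); a phase is the maximal subsequence of pseudo-requests processed between two consecutive calls to ResetBuckets. A fetch of $x$ during phase $P$ is clean if $x$ was not cached at the beginning of $P$, and stale otherwise. Expectations are over the random choices of Bucketing. *)

theory Defs
  imports "HOL-Probability.Probability" "HOL-Library.Extended_Nat"
begin

(* Dependency DAG: (x,y) \<in> E means x directly depends on y.
   The universe U is the whole type 'a; the total order \<tau> is the order of type 'a. *)

definition Tset :: "('a \<times> 'a) set \<Rightarrow> 'a \<Rightarrow> 'a set" where
  "Tset E x = {y. (x, y) \<in> E\<^sup>*}"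

definition feasible :: "('a \<times> 'a) set \<Rightarrow> nat \<Rightarrow> 'a set \<Rightarrow> bool" where
  "feasible E k S \<longleftrightarrow> finite S \<and> card S \<le> k \<and> (\<forall>x\<in>S. Tset E x \<subseteq> S)"

definition frozen :: "('a \<times> 'a) set \<Rightarrow> nat \<Rightarrow> 'a set \<Rightarrow> 'a::linorder set \<Rightarrow> bool" where
  "frozen E k S B \<longleftrightarrow> B = {} \<or> \<not> feasible E k (S - {Max B})"

definition discard_frozen ::
  "('a \<times> 'a) set \<Rightarrow> nat \<Rightarrow> 'a set \<Rightarrow> 'a::linorder set multiset \<Rightarrow> 'a set multiset" where
  "discard_frozen E k S \<Gamma> = filter_mset (\<lambda>B. \<not> frozen E k S B) \<Gamma>"

definition remove_items :: "'a set \<Rightarrow> 'a set multiset \<Rightarrow> 'a set multiset" where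
  "remove_items X \<Gamma> = image_mset (\<lambda>B. B - X) \<Gamma>"

definition reset_buckets :: "('a \<times> 'a) set \<Rightarrow> 'a set \<Rightarrow> 'a set multiset" where
  "reset_buckets E S =
     image_mset (Tset E) (mset_set {x \<in> S. \<forall>y\<in>S. y \<noteq> x \<longrightarrow> x \<notin> Tset E y})"

record 'a bstate =
  cache :: "'a set"
  gam   :: "'a set multiset"
  ph    :: nat              (* index of the current phase (0 = first phase) *)
  start :: "'a set"         (* cache content at the beginning of the current phase *)
  clean :: "nat \<Rightarrow> nat"      (* clean fetches per phase *)
  stale :: "nat \<Rightarrow> nat"      (* stale fetches per phase *)

definition fetch :: "'a \<Rightarrow> 'a bstate \<Rightarrow> 'a bstate" where
  "fetch w s =
     (if w \<in> start s
      then s\<lparr>cache := insert w (cache s), stale := (stale s)(ph s := stale s (ph s) + 1)\<rparr>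
      else s\<lparr>cache := insert w (cache s), clean := (clean s)(ph s := clean s (ph s) + 1)\<rparr>)"

definition step12 :: "('a \<times> 'a) set \<Rightarrow> nat \<Rightarrow> 'a::linorder set \<Rightarrow> 'a bstate \<Rightarrow> 'a bstate" where
  "step12 E k Tv s =
     (let s1 = s\<lparr>gam := discard_frozen E k (cache s) (remove_items Tv (gam s))\<rparr>
      in if gam s1 = {#}
         then s1\<lparr>gam := discard_frozen E k (cache s1) (remove_items Tv (reset_buckets E (cache s1))),
                 ph := ph s1 + 1, start := cache s1\<rparr>
         else s1)"

definition evict :: "('a \<times> 'a) set \<Rightarrow> nat \<Rightarrow> 'a::linorder bstate \<Rightarrow> 'a bstate pmf" where
  "evict E k s =
     (if card (cache s) \<ge> k \<and> gam s \<noteq> {#}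
      then do {
        B \<leftarrow> pmf_of_multiset (gam s);
        let y = Max B;
        return_pmf (s\<lparr>gam := discard_frozen E k (cache s) (remove_items {y} (gam s)),
                      cache := cache s - {y}\<rparr>)
      }
      else return_pmf s)"

(* processing of one pseudo-request w belonging to a request v with T(v) = Tv *)
definition pseudo_step :: "('a \<times> 'a) set \<Rightarrow> nat \<Rightarrow> 'a::linorder set \<Rightarrow> 'a \<Rightarrow> 'a bstate \<Rightarrow> 'a bstate pmf" where
  "pseudo_step E k Tv w s =
     (let s2 = step12 E k Tv s
      in if w \<in> cache s2 then return_pmf s2
         else map_pmf (fetch w) (evict E k s2))"

definition pseudo_seq :: "('a \<times> 'a) set \<Rightarrow> 'a::linorder list \<Rightarrow> ('a set \<times> 'a) list" where
  "pseudo_seq E \<sigma> = concat (map (\<lambda>v. map (\<lambda>w. (Tset E v, w)) (sorted_list_of_set (Tset E v))) \<sigma>)"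

definition init_state :: "('a \<times> 'a) set \<Rightarrow> 'a set \<Rightarrow> 'a bstate" where
  "init_state E C0 = \<lparr>cache = C0, gam = reset_buckets E C0, ph = 0, start = C0,
                       clean = (\<lambda>_. 0), stale = (\<lambda>_. 0)\<rparr>"

definition bucketing_run ::
  "('a \<times> 'a) set \<Rightarrow> nat \<Rightarrow> 'a::linorder set \<Rightarrow> 'a list \<Rightarrow> 'a bstate pmf" where
  "bucketing_run E k C0 \<sigma> =
     foldl (\<lambda>p (Tv, w). bind_pmf p (pseudo_step E k Tv w)) (return_pmf (init_state E C0)) (pseudo_seq E \<sigma>)"

definition ell :: "('a \<times> 'a) set \<Rightarrow> enat" where
  "ell E = Sup {enat (card S) | S. finite S \<and> (\<forall>x\<in>S. \<forall>y\<in>S. x \<noteq> y \<longrightarrow> (x, y) \<notin> E\<^sup>+)}"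

end

theory Submission
  imports Defs
begin

text \<open>
  While the cache is feasible, the \<open>\<tau>\<close>-maximum of every bucket is a root of the cache, i.e. a cached
  item below no other cached item.  The frozen test that accompanies the eviction of a root \<open>y\<close> still
  sees \<open>y\<close> in the cache, so what is left of the bucket of \<open>y\<close> is frozen at once.  A phase is therefore
  a marking algorithm on the roots: a uniformly random live root is evicted, and a root stops being
  live when it is evicted or requested.

  The requests are fixed, so each root has a deterministic time of its next request.  Charge every
  item \<open>y\<close> evicted in the phase \<open>H\<^sub>j\<close>, where \<open>j\<close> is the number of live roots whose next request comes
  after that of \<open>y\<close>.  Evicting a uniformly random one of \<open>n\<close> live roots adds on average at most
  \<open>(H\<^sub>0 + \<dots> + H\<^bsub>n-1\<^esub>) / n = H\<^sub>n - 1\<close>, and a stale fetch with \<open>n\<close> live roots releases \<open>H\<^sub>n\<close>, which pays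
  for itself and for the eviction that it causes.  Hence only clean fetches have to be paid for, with
  \<open>H\<^sub>n - 1\<close> each, and \<open>n \<le> min k \<ell>\<close> because the live roots are cached and form an antichain.
\<close>

section \<open>Harmonic sums over ranks\<close>

lemma sum_harm_lessThan:
  "(\<Sum>j<n. harm j) = of_nat n * harm n - (of_nat n :: 'a :: real_normed_field)"
proof (induction n)
  case (Suc n)
  have "(of_nat (Suc n) :: 'a) \<noteq> 0"
    using of_nat_neq_0 by blast
  then have "of_nat (Suc n) * harm (Suc n) = of_nat (Suc n) * harm n + (1 :: 'a)"
    by (simp add: harm_Suc distrib_left)
  then show ?case
    using Suc by (simp add: algebra_simps)
qed simp

text \<open>An element minimal for \<open>g\<close> has at most \<open>card L - 1\<close> later
  ones, and deleting it changes no other count; this gives the induction. Ties only lower the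
  counts, hence an inequality; they do occur, since items never requested again share one
  time.\<close>

lemma sum_card_later_le:
  fixes g :: "'a \<Rightarrow> 'b :: linorder" and h :: "nat \<Rightarrow> real"
  assumes "finite L" "mono h"
  shows "(\<Sum>y\<in>L. h (card {r\<in>L. g y < g r})) \<le> (\<Sum>j<card L. h j)"
  using assms(1)
proof (induction "card L" arbitrary: L)
  case (Suc n)
  then have "L \<noteq> {}" by auto
  then obtain y0 where y0: "y0 \<in> L" "\<And>y. y \<in> L \<Longrightarrow> g y0 \<le> g y"
    using arg_min_if_finite(1) arg_min_least Suc.prems by metis
  let ?L = "L - {y0}"
  have card: "card ?L = n"
    using Suc y0 by simp
  have same: "{r\<in>L. g y < g r} = {r\<in>?L. g y < g r}" if "y \<in> L" for y
    using y0(2)[OF that] by auto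
  have "card {r\<in>L. g y0 < g r} \<le> card ?L"
    using Suc.prems by (intro card_mono) auto
  then have "h (card {r\<in>L. g y0 < g r}) \<le> h n"
    using assms(2) card by (simp add: monoD)
  moreover have "(\<Sum>y\<in>?L. h (card {r\<in>L. g y < g r})) \<le> (\<Sum>j<n. h j)"
    using Suc.hyps(1)[of ?L] card Suc.prems same by simp
  ultimately show ?case
    using Suc.prems y0(1) Suc.hyps(2)[symmetric] by (simp add: sum.remove)
qed simp

lemma harm_real_mono: "mono (harm :: nat \<Rightarrow> real)"
  by (rule monoI) (rule harm_mono)

section \<open>Live roots, request times and the potential\<close>

definition roots :: "('a \<times> 'a) set \<Rightarrow> 'a set \<Rightarrow> 'a set" where
  "roots E C = {x \<in> C. \<forall>y\<in>C. y \<noteq> x \<longrightarrow> x \<notin> Tset E y}"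

text \<open>A bucket arises from some \<open>Tset E r\<close> by deleting items; as long as it
  contains \<open>r\<close>, its maximum is \<open>r\<close>, so \<open>Max\<close> recovers the
  root.\<close>

definition live :: "'a::linorder bstate \<Rightarrow> 'a set" where
  "live s = Max ` set_mset (gam s)"

text \<open>Items that are never requested again get the length of the list, the latest possible time.\<close>

definition next_request :: "('a set \<times> 'a) list \<Rightarrow> 'a \<Rightarrow> nat" where
  "next_request xs y = length (takeWhile (\<lambda>p. y \<notin> fst p) xs)"

lemma next_request_Cons:
  "next_request (p # xs) y = (if y \<in> fst p then 0 else Suc (next_request xs y))"
  by (simp add: next_request_def)

definition later :: "('a set \<times> 'a) list \<Rightarrow> 'a set \<Rightarrow> 'a \<Rightarrow> 'a set" where
  "later xs L y = {r\<in>L. next_request xs y < next_request xs r}"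

lemma later_mono: "L \<subseteq> L' \<Longrightarrow> later xs L y \<subseteq> later xs L' y"
  by (auto simp: later_def)

lemma later_Cons: "L \<inter> fst p = {} \<Longrightarrow> later xs L y \<subseteq> later (p # xs) L y"
  by (auto simp: later_def next_request_Cons)

lemma later_requested:
  "L \<inter> fst p = {} \<Longrightarrow> w \<in> fst p \<Longrightarrow> later (p # xs) L w = L"
  by (auto simp: later_def next_request_Cons)

text \<open>Only missing items of \<open>start s\<close> can be fetched stale, so evicted items
  outside \<open>start s\<close> carry no charge.\<close>

definition evicted_charge :: "('a set \<times> 'a) list \<Rightarrow> 'a::linorder bstate \<Rightarrow> real" where
  "evicted_charge xs s = (\<Sum>y\<in>start s - cache s. harm (card (later xs (live s) y)))"

lemma evicted_charge_nonneg: "evicted_charge xs s \<ge> 0"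
  unfolding evicted_charge_def by (intro sum_nonneg) (simp add: harm_nonneg)

text \<open>\<open>h\<close> is the price of a clean fetch, later \<open>harm ?m - 1\<close>. The
  charge counts only while the observed phase \<open>i\<close> is current.\<close>

definition potential :: "real \<Rightarrow> nat \<Rightarrow> ('a set \<times> 'a) list \<Rightarrow> 'a::linorder bstate \<Rightarrow> real" where
  "potential h i xs s =
     real (stale s i) - h * real (clean s i) + (if ph s = i then evicted_charge xs s else 0)"

text \<open>The subtrahend \<open>X\<close> stands for the items requested or evicted so far in the phase.\<close>

definition good_state :: "('a \<times> 'a) set \<Rightarrow> nat \<Rightarrow> 'a::linorder bstate \<Rightarrow> bool" where
  "good_state E k s \<longleftrightarrow> feasible E k (cache s) \<and> finite (start s) \<and> live s \<subseteq> roots E (cache s) \<and>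
     (\<exists>X. live s \<inter> X = {} \<and> gam s = image_mset (\<lambda>r. Tset E r - X) (mset_set (live s)))"

section \<open>Reachability, roots and feasible caches\<close>

lemma Tset_refl [simp]: "x \<in> Tset E x"
  by (simp add: Tset_def)

lemma Tset_trans: "y \<in> Tset E x \<Longrightarrow> Tset E y \<subseteq> Tset E x"
  by (auto simp: Tset_def)

lemma roots_subset: "roots E C \<subseteq> C"
  by (auto simp: roots_def)

lemma feasible_Diff_root:
  "feasible E k C \<Longrightarrow> r \<in> roots E C \<Longrightarrow> feasible E k (C - {r})"
  by (auto simp: feasible_def roots_def card_Diff_singleton_if)

text \<open>The trivial difference puts fresh buckets into the shape of the invariant
  \<open>good_state\<close>, with \<open>X = {}\<close>.\<close>

lemma reset_buckets_roots: "reset_buckets E C = image_mset (\<lambda>r. Tset E r - {}) (mset_set (roots E C))"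
  by (simp add: reset_buckets_def roots_def)

lemma card_antichain_le_ell:
  assumes "finite L" "L \<subseteq> roots E C"
  shows "enat (card L) \<le> ell E"
  unfolding ell_def
proof (rule Sup_upper, intro CollectI exI conjI refl ballI impI)
  fix x y assume "x \<in> L" "y \<in> L" "x \<noteq> y"
  then have "y \<notin> Tset E x"
    using assms(2) by (auto simp: roots_def)
  then show "(x, y) \<notin> E\<^sup>+"
    by (metis Tset_def mem_Collect_eq trancl_into_rtrancl)
qed (use assms in auto)

section \<open>Buckets of live roots under the order \<open>\<tau>\<close>\<close>

locale dependency_order =
  fixes E :: "('a::linorder \<times> 'a) set" and k :: nat
  assumes finite_Tset: "finite (Tset E x)"
    and card_Tset: "card (Tset E x) \<le> k"
    and Tset_less: "v \<in> Tset E u \<Longrightarrow> v \<noteq> u \<Longrightarrow> v < u"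
begin

lemma Max_Tset_Diff: "r \<notin> X \<Longrightarrow> Max (Tset E r - X) = r"
  using finite_Tset Tset_less by (intro Max_eqI) (auto intro: less_imp_le)

text \<open>The \<open>\<tau>\<close>-maximal cached item above \<open>x\<close> is a root: any
  cached item above it would also lie above \<open>x\<close> and be larger.\<close>

lemma below_root:
  assumes "finite C" "x \<in> C"
  obtains r where "r \<in> roots E C" "x \<in> Tset E r"
proof
  let ?A = "{y\<in>C. x \<in> Tset E y}"
  have A: "finite ?A" "?A \<noteq> {}"
    using assms by auto
  then have M: "Max ?A \<in> ?A" by (rule Max_in)
  then show "x \<in> Tset E (Max ?A)" by blast
  have "Max ?A \<notin> Tset E y" if "y \<in> C" "y \<noteq> Max ?A" for y
  proof
    assume y: "Max ?A \<in> Tset E y"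
    then have "y \<in> ?A" using M that Tset_trans[OF y] by auto
    then have "y \<le> Max ?A" using A by simp
    then show False using Tset_less[OF y] that by auto
  qed
  then show "Max ?A \<in> roots E C"
    using M unfolding roots_def by blast
qed

text \<open>If \<open>r\<close> is not in \<open>X\<close>, the bucket has maximum \<open>r\<close>,
  a root, whose eviction is feasible. If \<open>r\<close> is in \<open>X\<close>, any remaining
  maximum is a proper dependency of the still cached \<open>r\<close>, so the bucket is
  frozen.\<close>

lemma discard_frozen_roots:
  assumes C: "feasible E k C" and L: "L \<subseteq> roots E C"
  shows "discard_frozen E k C (image_mset (\<lambda>r. Tset E r - X) (mset_set L)) =
         image_mset (\<lambda>r. Tset E r - X) (mset_set (L - X))"
proof -
  have "frozen E k C (Tset E r - X) \<longleftrightarrow> r \<in> X" if r: "r \<in> L" for r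
  proof (cases "r \<in> X")
    case False
    then have "Tset E r - X \<noteq> {}" using Tset_refl[of r E] by blast
    then show ?thesis
      using False feasible_Diff_root[OF C, of r] L r by (auto simp: frozen_def Max_Tset_Diff)
  next
    case True
    show ?thesis
    proof (cases "Tset E r - X = {}")
      case False
      define z where "z = Max (Tset E r - X)"
      have z: "z \<in> Tset E r - X"
        unfolding z_def using False finite_Tset by (intro Max_in) auto
      then have "r \<in> C - {z}" using True L r by (auto simp: roots_def)
      then have "\<not> feasible E k (C - {z})"
        using z by (auto simp: feasible_def)
      then show ?thesis using True by (simp add: frozen_def z_def)
    qed (simp add: frozen_def True)
  qed
  moreover have "finite L"
    using C L roots_subset finite_subset unfolding feasible_def by metis
  ultimately have "filter_mset (\<lambda>r. \<not> frozen E k C (Tset E r - X)) (mset_set L) = mset_set (L - X)"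
    by (simp add: filter_mset_mset_set set_diff_eq cong: conj_cong)
  then show ?thesis
    by (simp add: discard_frozen_def filter_mset_image_mset o_def)
qed

lemma remove_items_roots:
  "remove_items Y (image_mset (\<lambda>r. Tset E r - X) M) = image_mset (\<lambda>r. Tset E r - (X \<union> Y)) M"
  by (simp add: remove_items_def multiset.map_comp o_def Diff_Un set_diff_eq)

lemma live_roots:
  assumes "finite L" "L \<inter> X = {}" "gam s = image_mset (\<lambda>r. Tset E r - X) (mset_set L)"
  shows "live s = L"
proof -
  have "(\<lambda>r. Max (Tset E r - X)) ` L = id ` L"
    using assms(2) by (intro image_cong refl) (simp add: Max_Tset_Diff disjoint_iff)
  then show ?thesis
    using assms by (simp add: live_def image_image)
qed

lemma good_stateI:
  assumes "feasible E k (cache s)" "finite (start s)" "L \<subseteq> roots E (cache s)" "L \<inter> X = {}"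
    "gam s = image_mset (\<lambda>r. Tset E r - X) (mset_set L)"
  shows "good_state E k s" "live s = L"
proof -
  have "finite L"
    using assms(1,3) roots_subset finite_subset unfolding feasible_def by metis
  then show "live s = L" using live_roots assms by blast
  then show "good_state E k s"
    unfolding good_state_def using assms by blast
qed

lemma good_stateE:
  assumes "good_state E k s"
  obtains X where "feasible E k (cache s)" "finite (start s)" "live s \<subseteq> roots E (cache s)"
    "finite (live s)" "live s \<inter> X = {}"
    "gam s = image_mset (\<lambda>r. Tset E r - X) (mset_set (live s))"
  using assms roots_subset finite_subset unfolding good_state_def feasible_def by metis

section \<open>Effect of resets, evictions and fetches\<close>

lemma evicted_charge_antimono:
  assumes "finite (start s)" "finite (live s)" "start t = start s"
    "start t - cache t \<subseteq> start s - cache s" "live t \<subseteq> live s"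
  shows "evicted_charge xs t \<le> evicted_charge xs s"
proof -
  have "evicted_charge xs t \<le> (\<Sum>y\<in>start t - cache t. harm (card (later xs (live s) y)))"
    unfolding evicted_charge_def
    by (intro sum_mono harm_mono card_mono later_mono assms)
      (use assms(2) in \<open>auto simp: later_def\<close>)
  also have "\<dots> \<le> evicted_charge xs s"
    unfolding evicted_charge_def
    by (intro sum_mono2 assms) (use assms(1) in \<open>auto simp: harm_nonneg\<close>)
  finally show ?thesis .
qed

lemma evicted_charge_Cons:
  assumes "finite (live s)" "live s \<inter> fst p = {}"
  shows "evicted_charge xs s \<le> evicted_charge (p # xs) s"
  unfolding evicted_charge_def
  by (intro sum_mono harm_mono card_mono later_Cons assms)
    (use assms(1) in \<open>auto simp: later_def\<close>)

text \<open>Within a phase \<open>live\<close> only shrinks, which lowers the charge. A reset drops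
  the old nonnegative charge and starts with none, as \<open>start\<close> equals the cache. No live
  root can remain only after a reset in which \<open>Tset E v\<close> contains every root and thus
  the whole cache.\<close>

lemma step12_good:
  fixes v s defines "t \<equiv> step12 E k (Tset E v) s"
  assumes s: "good_state E k s"
  shows "good_state E k t" "live t \<inter> Tset E v = {}" "cache t = cache s"
    "potential h i xs t \<le> potential h i xs s"
    "live t = {} \<Longrightarrow> start t = cache s \<and> cache s \<subseteq> Tset E v"
proof -
  let ?Tv = "Tset E v" and ?C = "cache s"
  obtain X where X: "feasible E k ?C" "finite (start s)" "live s \<subseteq> roots E ?C"
    "finite (live s)" "live s \<inter> X = {}"
    "gam s = image_mset (\<lambda>r. Tset E r - X) (mset_set (live s))"
    using good_stateE[OF s] by metis
  have fin: "finite ?C" using X(1) by (simp add: feasible_def)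
  have fr: "finite (roots E ?C)" using fin roots_subset by (metis finite_subset)
  let ?g = "image_mset (\<lambda>r. Tset E r - (X \<union> ?Tv)) (mset_set (live s - ?Tv))"
  have "live s - (X \<union> ?Tv) = live s - ?Tv" using X(5) by auto
  then have g: "discard_frozen E k ?C (remove_items ?Tv (gam s)) = ?g"
    by (subst X(6)) (simp add: remove_items_roots discard_frozen_roots X)
  let ?h = "image_mset (\<lambda>r. Tset E r - ({} \<union> ?Tv)) (mset_set (roots E ?C - ?Tv))"
  have h: "discard_frozen E k ?C (remove_items ?Tv (reset_buckets E ?C)) = ?h"
    unfolding reset_buckets_roots remove_items_roots
    using discard_frozen_roots[OF X(1) order_refl, of ?Tv] by simp
  show c: "cache t = ?C"
    by (simp add: t_def step12_def Let_def)
  have "good_state E k t \<and> live t \<inter> ?Tv = {} \<and> potential h i xs t \<le> potential h i xs s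
    \<and> (live t = {} \<longrightarrow> start t = ?C \<and> ?C \<subseteq> ?Tv)"
  proof (cases "?g = {#}")
    case True
    have gt: "gam t = ?h" and st: "start t = ?C" and
      rest: "stale t = stale s" "clean t = clean s"  "ph t = Suc (ph s)"
      using True by (simp_all add: t_def step12_def Let_def g h)
    have gl: "good_state E k t" "live t = roots E ?C - ?Tv"
      using good_stateI[of t "roots E ?C - ?Tv" "{} \<union> ?Tv"] X fin gt st c by auto
    moreover have "potential h i xs t \<le> potential h i xs s"
      using evicted_charge_nonneg[of xs s] unfolding potential_def rest
      by (simp add: evicted_charge_def st c)
    moreover have "?C \<subseteq> ?Tv" if "live t = {}"
    proof
      fix x assume "x \<in> ?C"
      then obtain r where "r \<in> roots E ?C" "x \<in> Tset E r"
        using below_root fin by blast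
      then show "x \<in> ?Tv" using Tset_trans[of r E v] that gl by auto
    qed
    ultimately show ?thesis
      using st by auto
  next
    case False
    have gt: "gam t = ?g" and st: "start t = start s" and
      rest: "stale t = stale s" "clean t = clean s"  "ph t = ph s"
      using False by (simp_all add: t_def step12_def Let_def g h)
    have gl: "good_state E k t" "live t = live s - ?Tv"
    proof -
      have "feasible E k (cache t)" "finite (start t)" "live s - ?Tv \<subseteq> roots E (cache t)"
        "(live s - ?Tv) \<inter> (X \<union> ?Tv) = {}"
        using X st c by auto
      then show "good_state E k t" "live t = live s - ?Tv"
        using good_stateI gt by metis+
    qed
    moreover have "evicted_charge xs t \<le> evicted_charge xs s"
      using X gl st c by (intro evicted_charge_antimono) auto
    moreover have "live t \<noteq> {}"
      using False gl(2) X(4) by (auto simp: mset_set_empty_iff)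
    ultimately show ?thesis
      by (auto simp: potential_def rest)
  qed
  then show "good_state E k t" "live t \<inter> ?Tv = {}" "potential h i xs t \<le> potential h i xs s"
    "live t = {} \<Longrightarrow> start t = ?C \<and> ?C \<subseteq> ?Tv"
    by auto
qed

definition evict_item :: "'a \<Rightarrow> 'a bstate \<Rightarrow> 'a bstate" where
  "evict_item y s = s\<lparr>gam := discard_frozen E k (cache s) (remove_items {y} (gam s)),
                      cache := cache s - {y}\<rparr>"

text \<open>\<open>gam s\<close> holds one bucket per live root, and \<open>Max\<close> maps it
  back, so a uniform bucket is a uniform live root.\<close>

lemma evict_eq:
  assumes s: "good_state E k s" and "card (cache s) \<ge> k" "live s \<noteq> {}"
  shows "evict E k s = map_pmf (\<lambda>y. evict_item y s) (pmf_of_set (live s))"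
proof -
  obtain X where X: "finite (live s)" "live s \<inter> X = {}"
    "gam s = image_mset (\<lambda>r. Tset E r - X) (mset_set (live s))"
    using good_stateE[OF s] by metis
  have ne: "gam s \<noteq> {#}" using assms(3) by (auto simp: live_def)
  have "evict E k s = map_pmf (\<lambda>B. evict_item (Max B) s) (pmf_of_multiset (gam s))"
    using assms(2) ne by (simp add: evict_def evict_item_def map_pmf_def Let_def)
  also have "pmf_of_multiset (gam s) = map_pmf (\<lambda>r. Tset E r - X) (pmf_of_set (live s))"
    using map_pmf_of_set[of "live s" "\<lambda>r. Tset E r - X"] X assms(3) by simp
  also have "map_pmf (\<lambda>B. evict_item (Max B) s) \<dots> = map_pmf (\<lambda>y. evict_item y s) (pmf_of_set (live s))"
    unfolding map_pmf_comp
    by (intro map_pmf_cong refl) (use X assms(3) in \<open>simp add: Max_Tset_Diff disjoint_iff\<close>)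
  finally show ?thesis .
qed

text \<open>The item \<open>y\<close> joins the set \<open>X\<close> of the invariant; frozenness is
  tested with \<open>y\<close> still cached, so exactly its bucket disappears.\<close>

lemma evict_item_good:
  assumes s: "good_state E k s" and y: "y \<in> live s"
  shows "good_state E k (evict_item y s)" "live (evict_item y s) = live s - {y}"
proof -
  obtain X where X: "feasible E k (cache s)" "finite (start s)" "live s \<subseteq> roots E (cache s)"
    "finite (live s)" "live s \<inter> X = {}"
    "gam s = image_mset (\<lambda>r. Tset E r - X) (mset_set (live s))"
    using good_stateE[OF s] by metis
  have "live s - (X \<union> {y}) = live s - {y}" using X(5) by auto
  then have "gam (evict_item y s) = image_mset (\<lambda>r. Tset E r - (X \<union> {y})) (mset_set (live s - {y}))"
    using discard_frozen_roots[OF X(1,3), of "X \<union> {y}"]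
    by (subst evict_item_def, simp del: Un_insert_right, subst X(6), simp only: remove_items_roots)
  moreover have "feasible E k (cache (evict_item y s))"
    using feasible_Diff_root[OF X(1)] X(3) y by (auto simp: evict_item_def)
  moreover have "live s - {y} \<subseteq> roots E (cache (evict_item y s))"
    using X(3) by (auto simp: evict_item_def roots_def)
  moreover have "finite (start (evict_item y s))"
    using X(2) by (simp add: evict_item_def)
  moreover have "(live s - {y}) \<inter> (X \<union> {y}) = {}" using X(5) by auto
  ultimately show "good_state E k (evict_item y s)" "live (evict_item y s) = live s - {y}"
    using good_stateI by blast+
qed

text \<open>A live root could stop being a root only by lying in \<open>Tset E w\<close>, which is
  excluded; the other dependencies of \<open>w\<close> are already cached.\<close>

lemma fetch_good:
  assumes s: "good_state E k s" and w: "Tset E w - {w} \<subseteq> cache s"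
    and L: "live s \<inter> Tset E w = {}" and c: "card (cache s) < k"
  shows "good_state E k (fetch w s)" "live (fetch w s) = live s"
proof -
  obtain X where X: "feasible E k (cache s)" "finite (start s)" "live s \<subseteq> roots E (cache s)"
    "live s \<inter> X = {}"
    "gam s = image_mset (\<lambda>r. Tset E r - X) (mset_set (live s))"
    using good_stateE[OF s] by metis
  have fe: "cache (fetch w s) = insert w (cache s)" "gam (fetch w s) = gam s"
    "start (fetch w s) = start s"
    by (auto simp: fetch_def)
  have "feasible E k (insert w (cache s))"
    using X(1) w c by (auto simp: feasible_def card_insert_if)
  moreover have "live s \<subseteq> roots E (insert w (cache s))"
    using X(3) L by (auto simp: roots_def)
  ultimately show "good_state E k (fetch w s)" "live (fetch w s) = live s"
    using X fe good_stateI[of "fetch w s" "live s" X] by auto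
qed

section \<open>Expected change of the potential in one iteration\<close>

lemma evicted_charge_fetch:
  assumes s: "finite (start s)" "finite (live s)" "live s \<inter> fst p = {}"
    and w: "w \<in> fst p" "w \<notin> cache s"
    and t: "start t = start s" "live t \<subseteq> live s" "start s - cache t \<subseteq> D \<union> (start s - cache s - {w})"
    and D: "finite D"
  shows "evicted_charge xs t \<le> evicted_charge (p # xs) s
    - (if w \<in> start s then harm (card (live s)) else 0) + (\<Sum>y\<in>D. harm (card (later xs (live s) y)))"
proof -
  let ?f = "\<lambda>xs y. harm (card (later xs (live s) y)) :: real" and ?S = "start s - cache s - {w}"
  have nn: "?f xs y \<ge> 0" for xs y by (rule harm_nonneg)
  have fin: "finite (later xs (live s) y)" for xs y
    using s(2) by (simp add: later_def)
  have "evicted_charge xs t \<le> (\<Sum>y\<in>start t - cache t. ?f xs y)"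
    unfolding evicted_charge_def
    by (intro sum_mono harm_mono card_mono later_mono t(2) fin)
  also have "\<dots> \<le> (\<Sum>y\<in>D \<union> ?S. ?f xs y)"
    using s(1) t D nn by (intro sum_mono2) auto
  also have "\<dots> \<le> sum (?f xs) D + sum (?f xs) ?S"
    using s(1) D nn by (subst sum_Un) (auto intro!: sum_nonneg)
  also have "sum (?f xs) ?S \<le> sum (?f (p # xs)) ?S"
    by (intro sum_mono harm_mono card_mono later_Cons s(3) fin)
  \<comment> \<open>A stale \<open>w\<close> loses its own term; being requested now, it has every
    live root later, so the term is \<open>harm (card (live s))\<close>.\<close>
  also have "\<dots> = evicted_charge (p # xs) s - (if w \<in> start s then harm (card (live s)) else 0)"
    using s w by (auto simp: evicted_charge_def sum_diff1 later_requested)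
  finally show ?thesis by simp
qed

lemma avg_harm_later_le:
  assumes "finite L" "L \<noteq> {}"
  shows "(\<Sum>y\<in>L. harm (card (later xs L y))) / card L \<le> (harm (card L) - 1 :: real)"
proof -
  have "(\<Sum>y\<in>L. harm (card (later xs L y))) \<le> (real (card L) * harm (card L) - card L :: real)"
    unfolding later_def sum_harm_lessThan[symmetric]
    by (rule sum_card_later_le[OF assms(1) harm_real_mono])
  then show ?thesis
    using assms by (simp add: field_simps card_gt_0_iff)
qed

text \<open>\<open>D\<close> contains what was evicted to make room: it will be empty if there is
  space and a singleton otherwise, so one estimate serves both cases.\<close>

lemma potential_fetch:
  assumes s: "finite (start s)" "finite (live s)" "live s \<inter> fst p = {}"
    and w: "w \<in> fst p" "w \<notin> cache s"
    and t: "start t = start s" "live t \<subseteq> live s" "cache s - cache t \<subseteq> D"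
      "ph t = ph s" "stale t = stale s" "clean t = clean s"
    and D: "finite D"
  shows "potential h i xs (fetch w t) \<le> potential h i (p # xs) s +
    (if ph s = i then (if w \<in> start s then 1 - harm (card (live s)) else - h)
       + (\<Sum>y\<in>D. harm (card (later xs (live s) y))) else 0)"
proof -
  have "live (fetch w t) = live t" by (simp add: live_def fetch_def)
  then have "evicted_charge xs (fetch w t) \<le> evicted_charge (p # xs) s
    - (if w \<in> start s then harm (card (live s)) else 0) + (\<Sum>y\<in>D. harm (card (later xs (live s) y)))"
    using t by (intro evicted_charge_fetch s w D) (auto simp: fetch_def)
  then show ?thesis
    using t by (auto simp: potential_def fetch_def algebra_simps)
qed

text \<open>The potential is a supermartingale. The inclusion in the second claim says that items of
  the current request stay cached once present, which keeps \<open>pending\<close> true.\<close>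

lemma pseudo_step_good:
  fixes s v w
  assumes s: "good_state E k s" and w: "w \<in> Tset E v" "Tset E w - {w} \<subseteq> cache s"
    and h: "\<And>L C. finite C \<Longrightarrow> card C \<le> k \<Longrightarrow> L \<subseteq> roots E C \<Longrightarrow> harm (card L) - 1 \<le> h" "0 \<le> h"
  defines "p \<equiv> pseudo_step E k (Tset E v) w s"
  shows "finite (set_pmf p)"
    "\<And>t. t \<in> set_pmf p \<Longrightarrow> good_state E k t \<and> cache s \<inter> Tset E v \<union> {w} \<subseteq> cache t"
    "measure_pmf.expectation p (potential h i xs) \<le> potential h i ((Tset E v, w) # xs) s"
proof -
  let ?Tv = "Tset E v" and ?q = "(Tset E v, w)"
  define t where "t = step12 E k ?Tv s"
  note st = step12_good[OF s, where v = v, folded t_def]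
  obtain X where X: "feasible E k (cache t)" "finite (start t)" "live t \<subseteq> roots E (cache t)"
    "finite (live t)"
    using good_stateE[OF st(1)] by metis
  have fin: "finite (cache t)" "card (cache t) \<le> k" using X(1) by (auto simp: feasible_def)
  have Tw: "Tset E w \<subseteq> ?Tv" using Tset_trans w(1) by metis
  have hn: "harm (card (live t)) - 1 \<le> h" using h(1) fin X(3) by blast
  have pot_t: "potential h i (?q # xs) t \<le> potential h i (?q # xs) s" by (rule st(4))
  have "finite (set_pmf p) \<and>
    (\<forall>t \<in> set_pmf p. good_state E k t \<and> cache s \<inter> Tset E v \<union> {w} \<subseteq> cache t) \<and>
    measure_pmf.expectation p (potential h i xs) \<le> potential h i (?q # xs) t"
  proof (cases "w \<in> cache t")
    case True
    have "p = return_pmf t" using True by (simp add: p_def pseudo_step_def t_def)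
    moreover have "potential h i xs t \<le> potential h i (?q # xs) t"
      using evicted_charge_Cons[OF X(4), of ?q xs] st(2) by (auto simp: potential_def)
    ultimately show ?thesis using st True by auto
  next
    case False
    have p: "p = map_pmf (fetch w) (evict E k t)"
      using False by (simp add: p_def pseudo_step_def t_def)
    show ?thesis
    proof (cases "card (cache t) < k")
      case True
      then have p: "p = return_pmf (fetch w t)" by (simp add: p evict_def)
      \<comment> \<open>Without an eviction, a stale fetch needs a release of at least 1. A live
        root exists, for otherwise \<open>start t\<close> would equal the cache and contain
        \<open>w\<close>.\<close>
      have "harm (card (live t)) \<ge> (1::real)" if "w \<in> start t"
      proof -
        have "live t \<noteq> {}" using st(5,3) that False by auto
        then have "card (live t) \<ge> 1" using X(4) by (simp add: Suc_le_eq card_gt_0_iff)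
        then have "harm 1 \<le> (harm (card (live t)) :: real)" by (rule harm_mono)
        then show ?thesis by (simp add: harm_expand)
      qed
      then have "potential h i xs (fetch w t) \<le> potential h i (?q # xs) t"
        using potential_fetch[OF X(2,4), of ?q w t "{}" h i xs] st(2) w(1) False h(2)
        by (auto split: if_splits)
      moreover have "good_state E k (fetch w t)"
        using st Tw w True by (intro fetch_good) auto
      ultimately show ?thesis using st by (auto simp: p fetch_def)
    next
      case full: False
      \<comment> \<open>Without live roots the full cache would lie strictly inside
        \<open>Tset E v\<close>, which has at most \<open>k\<close> items.\<close>
      have ne: "live t \<noteq> {}"
      proof
        assume "live t = {}"
        then have "cache t \<subset> ?Tv" using st(5,3) False w(1) by auto
        then have "card (cache t) < card ?Tv" by (rule psubset_card_mono[OF finite_Tset])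
        then show False using card_Tset[of v] full by simp
      qed
      let ?e = "\<lambda>y. evict_item y t" and ?L = "live t"
      have ev: "cache (?e y) = cache t - {y}" "start (?e y) = start t" "ph (?e y) = ph t"
        "stale (?e y) = stale t" "clean (?e y) = clean t" for y
        by (simp_all add: evict_item_def)
      have p: "p = map_pmf (\<lambda>y. fetch w (?e y)) (pmf_of_set ?L)"
        using full by (simp add: p evict_eq[OF st(1) _ ne] map_pmf_comp)
      have good: "good_state E k (fetch w (?e y)) \<and>
          cache s \<inter> ?Tv \<union> {w} \<subseteq> cache (fetch w (?e y))" if y: "y \<in> ?L" for y
      proof
        have yT: "y \<notin> ?Tv" using y st(2) by auto
        have "y \<in> cache t" using y X(3) roots_subset[of E "cache t"] by auto
        then have "card (cache (?e y)) < k"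
          using fin card_Diff1_less[OF fin(1), of y] by (simp add: ev)
        then show "good_state E k (fetch w (?e y))"
          using evict_item_good[OF st(1) y] st Tw w yT
          by (intro fetch_good) (auto simp: ev)
        show "cache s \<inter> ?Tv \<union> {w} \<subseteq> cache (fetch w (?e y))"
          using yT st(3) by (auto simp: fetch_def ev)
      qed
      \<comment> \<open>\<open>a\<close> bounds the fetch part in both cases: a stale fetch
        contributes exactly \<open>1 - harm (card ?L)\<close>, a clean one \<open>- h\<close>, which
        is no larger. \<open>c y\<close> is the new charge of the victim.\<close>
      define a where "a = (if ph t = i then 1 - harm (card ?L) else 0 :: real)"
      define c where "c y = (if ph t = i then harm (card (later xs ?L y)) else 0 :: real)" for y
      have pot: "potential h i xs (fetch w (?e y)) \<le> potential h i (?q # xs) t + a + c y"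
        if y: "y \<in> ?L" for y
      proof -
        have "cache t - cache (?e y) \<subseteq> {y}" by (auto simp: ev)
        then have "potential h i xs (fetch w (?e y)) \<le> potential h i (?q # xs) t +
          (if ph t = i then (if w \<in> start t then 1 - harm (card ?L) else - h)
             + (\<Sum>y\<in>{y}. harm (card (later xs ?L y))) else 0)"
          using st(2) w(1) False evict_item_good(2)[OF st(1) y]
          by (intro potential_fetch X) (auto simp: ev)
        then show ?thesis using hn by (auto simp: a_def c_def split: if_splits)
      qed
      have card0: "real (card ?L) > 0" using X(4) ne by (simp add: card_gt_0_iff)
      have "measure_pmf.expectation p (potential h i xs)
          = (\<Sum>y\<in>?L. potential h i xs (fetch w (?e y))) / card ?L"
        by (simp add: p integral_pmf_of_set[OF ne X(4)])
      also have "\<dots> \<le> (\<Sum>y\<in>?L. potential h i (?q # xs) t + a + c y) / card ?L"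
        by (intro divide_right_mono sum_mono pot) auto
      also have "\<dots> = potential h i (?q # xs) t + (a + sum c ?L / card ?L)"
        using card0 by (simp add: sum.distrib field_simps)
      \<comment> \<open>The average of \<open>c\<close> is at most \<open>harm (card ?L) - 1\<close>
        in phase \<open>i\<close>, which cancels \<open>a\<close>.\<close>
      also have "\<dots> \<le> potential h i (?q # xs) t"
        using avg_harm_later_le[OF X(4) ne, of xs] by (auto simp: a_def c_def)
      finally show ?thesis
        using good X(4) ne by (auto simp: p)
    qed
  qed
  then show "finite (set_pmf p)"
    "\<And>t. t \<in> set_pmf p \<Longrightarrow> good_state E k t \<and> cache s \<inter> Tset E v \<union> {w} \<subseteq> cache t"
    "measure_pmf.expectation p (potential h i xs) \<le> potential h i (?q # xs) s"
    using pot_t by auto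
qed

section \<open>Order of the remaining pseudo-requests\<close>

text \<open>The remaining pseudo-requests, of which the first ones may belong to a request in progress.\<close>

definition pending :: "'a set \<Rightarrow> ('a set \<times> 'a) list \<Rightarrow> bool" where
  "pending C xs \<longleftrightarrow> (\<exists>v ws \<sigma>. xs = map (Pair (Tset E v)) ws @ pseudo_seq E \<sigma> \<and>
     sorted ws \<and> distinct ws \<and> set ws \<subseteq> Tset E v \<and> (\<forall>w\<in>set ws. Tset E w \<subseteq> C \<union> set ws))"

text \<open>Proper dependencies of the first item \<open>w\<close> are
  \<open>\<tau>\<close>-smaller, so they cannot occur in the sorted remainder of the request and
  must be in \<open>C\<close>.\<close>

lemma pending_Cons:
  assumes "pending C (p # xs)"
  obtains v w where "p = (Tset E v, w)" "w \<in> Tset E v" "Tset E w - {w} \<subseteq> C"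
    "\<And>D. C \<inter> Tset E v \<union> {w} \<subseteq> D \<Longrightarrow> pending D xs"
proof -
  have "\<exists>v w ws \<sigma>. p # xs = map (Pair (Tset E v)) (w # ws) @ pseudo_seq E \<sigma> \<and>
     sorted (w # ws) \<and> distinct (w # ws) \<and> set (w # ws) \<subseteq> Tset E v \<and>
     (\<forall>u\<in>set (w # ws). Tset E u \<subseteq> C \<union> set (w # ws))"
  proof -
    obtain v ws \<sigma> where *: "p # xs = map (Pair (Tset E v)) ws @ pseudo_seq E \<sigma>"
      "sorted ws" "distinct ws" "set ws \<subseteq> Tset E v" "\<forall>w\<in>set ws. Tset E w \<subseteq> C \<union> set ws"
      using assms unfolding pending_def by blast
    show ?thesis
    proof (cases ws)
      case Nil
      \<comment> \<open>The request in progress is finished, so \<open>p\<close> opens the next one,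
        whose list is nonempty because \<open>u\<close> reaches itself.\<close>
      with * obtain u \<sigma>' where \<sigma>: "\<sigma> = u # \<sigma>'"
        by (cases \<sigma>) (auto simp: pseudo_seq_def)
      have set: "set (sorted_list_of_set (Tset E u)) = Tset E u"
        using finite_Tset by simp
      then obtain w us where us: "sorted_list_of_set (Tset E u) = w # us"
        by (cases "sorted_list_of_set (Tset E u)") (use Tset_refl[of u E] in auto)
      have "p # xs = map (Pair (Tset E u)) (w # us) @ pseudo_seq E \<sigma>'"
        using * Nil \<sigma> us by (simp add: pseudo_seq_def)
      moreover have "sorted (w # us)" "distinct (w # us)"
        using sorted_sorted_list_of_set distinct_sorted_list_of_set us by metis+
      moreover have "\<forall>x\<in>set (w # us). Tset E x \<subseteq> C \<union> set (w # us)"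
        using set Tset_trans[of _ E u] unfolding us by blast
      moreover have "set (w # us) \<subseteq> Tset E u" using set unfolding us by blast
      ultimately show ?thesis by blast
    next
      case (Cons w us)
      then show ?thesis using * by blast
    qed
  qed
  then obtain v w ws \<sigma> where *: "p = (Tset E v, w)" "xs = map (Pair (Tset E v)) ws @ pseudo_seq E \<sigma>"
    "sorted (w # ws)" "distinct (w # ws)" "set (w # ws) \<subseteq> Tset E v"
    "\<forall>u\<in>set (w # ws). Tset E u \<subseteq> C \<union> set (w # ws)"
    by auto
  show thesis
  proof
    show "Tset E w - {w} \<subseteq> C"
    proof
      fix u assume u: "u \<in> Tset E w - {w}"
      then have "u < w" using Tset_less by blast
      then have "u \<notin> set (w # ws)" using *(3) by auto
      then show "u \<in> C" using *(6) u by auto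
    qed
    show "pending D xs" if "C \<inter> Tset E v \<union> {w} \<subseteq> D" for D
    proof -
      have "Tset E x \<subseteq> D \<union> set ws" if "x \<in> set ws" for x
        using *(5,6) that \<open>C \<inter> Tset E v \<union> {w} \<subseteq> D\<close> Tset_trans[of x E v] by fastforce
      then show ?thesis
        unfolding pending_def using * by (intro exI[of _ v] exI[of _ ws] exI[of _ \<sigma>]) auto
    qed
  qed (use * in auto)
qed

section \<open>Expectation over the whole run\<close>

definition step :: "'a set \<times> 'a \<Rightarrow> 'a bstate \<Rightarrow> 'a bstate pmf" where
  "step p = pseudo_step E k (fst p) (snd p)"

text \<open>Recursion from the first pseudo-request and an arbitrary state fits a potential that
  depends on the remaining list.\<close>

primrec run :: "('a set \<times> 'a) list \<Rightarrow> 'a bstate \<Rightarrow> 'a bstate pmf" where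
  "run [] = return_pmf"
| "run (p # xs) = (\<lambda>s. bind_pmf (step p s) (run xs))"

lemma foldl_bind_run:
  "foldl (\<lambda>q (Tv, w). bind_pmf q (pseudo_step E k Tv w)) q xs = bind_pmf q (run xs)"
  by (induction xs arbitrary: q)
    (simp_all add: bind_return_pmf' bind_assoc_pmf step_def case_prod_unfold)

text \<open>The one-step bounds telescope, and the charge left at the end is nonnegative and
  dropped. Finite support turns the expectations into finite sums.\<close>

lemma expectation_run:
  assumes "good_state E k s" "pending (cache s) xs"
    and h: "\<And>L C. finite C \<Longrightarrow> card C \<le> k \<Longrightarrow> L \<subseteq> roots E C \<Longrightarrow> harm (card L) - 1 \<le> h" "0 \<le> h"
  shows "finite (set_pmf (run xs s)) \<and>
    measure_pmf.expectation (run xs s) (\<lambda>s. real (stale s i) - h * real (clean s i)) \<le> potential h i xs s"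
  using assms(1,2)
proof (induction xs arbitrary: s)
  case Nil
  then show ?case
    using evicted_charge_nonneg[of "[]" s] by (simp add: potential_def)
next
  case (Cons p xs)
  let ?f = "\<lambda>s. real (stale s i) - h * real (clean s i)"
  obtain v w where p: "p = (Tset E v, w)" "w \<in> Tset E v" "Tset E w - {w} \<subseteq> cache s"
    "\<And>D. cache s \<inter> Tset E v \<union> {w} \<subseteq> D \<Longrightarrow> pending D xs"
    using pending_Cons[OF Cons.prems(2)] by metis
  note step = pseudo_step_good[OF Cons.prems(1) p(2,3) h]
  have st: "step p s = pseudo_step E k (Tset E v) w s" by (simp add: step_def p(1))
  let ?q = "step p s"
  have fin: "finite (set_pmf ?q)" unfolding st by (rule step(1))
  have IH: "finite (set_pmf (run xs t))"
    "measure_pmf.expectation (run xs t) ?f \<le> potential h i xs t" if "t \<in> set_pmf ?q" for t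
    using Cons.IH[of t] step(2)[where t = t] p(4) that st by auto
  have "measure_pmf.expectation (run (p # xs) s) ?f
      = (\<Sum>t\<in>set_pmf ?q. pmf ?q t * measure_pmf.expectation (run xs t) ?f)"
    unfolding run.simps using fin IH(1) by (subst pmf_expectation_bind[of "set_pmf ?q"]) auto
  also have "\<dots> \<le> (\<Sum>t\<in>set_pmf ?q. pmf ?q t * potential h i xs t)"
    by (intro sum_mono mult_left_mono IH) auto
  also have "\<dots> = measure_pmf.expectation ?q (potential h i xs)"
    using integral_measure_pmf[OF fin, of ?q "potential h i xs"] by simp
  also have "\<dots> \<le> potential h i (p # xs) s"
    unfolding st unfolding p(1) by (rule step(3))
  finally show ?case using fin IH(1) by simp
qed

end

theorem mainTheorem5:
  fixes E :: "('a::linorder \<times> 'a) set" and k :: nat and C0 :: "'a set" and \<sigma> :: "'a list" and i :: nat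
  assumes "acyclic E"
    and "k \<ge> 1"
    and "\<forall>x. finite (Tset E x) \<and> card (Tset E x - {x}) \<le> k - 1"
    and "\<forall>u v. v \<in> Tset E u \<and> v \<noteq> u \<longrightarrow> v < u"
    and "feasible E k C0"
  shows "measure_pmf.expectation (bucketing_run E k C0 \<sigma>) (\<lambda>s. real (clean s i + stale s i))
         \<le> harm (the_enat (min (enat k) (ell E)))
            * measure_pmf.expectation (bucketing_run E k C0 \<sigma>) (\<lambda>s. real (clean s i))"
proof -
  interpret dependency_order E k
  proof
    show "card (Tset E x) \<le> k" for x
      using assms(2,3) by (metis Tset_refl card_Suc_Diff1 Suc_le_mono Suc_diff_1 less_eq_Suc_le One_nat_def)
  qed (use assms in blast)+
  let ?m = "the_enat (min (enat k) (ell E))"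
  \<comment> \<open>\<open>ell E\<close> may be infinite, but the minimum with \<open>enat k\<close>
    is finite, so \<open>the_enat\<close> loses nothing.\<close>
  have m: "enat ?m = min (enat k) (ell E)"
    by (auto simp: min_def split: if_splits) (metis enat_ile enat_ord_simps(4) linorder_linear the_enat.simps)
  have card_le: "card L \<le> ?m" if "finite C" "card C \<le> k" "L \<subseteq> roots E C" for L C
  proof -
    have LC: "L \<subseteq> C" by (rule subset_trans[OF that(3) roots_subset])
    have "enat (card L) \<le> ell E"
      by (rule card_antichain_le_ell[OF finite_subset[OF LC that(1)] that(3)])
    moreover have "card L \<le> k"
      using card_mono[OF that(1) LC] that(2) by (rule order_trans)
    ultimately have "enat (card L) \<le> enat ?m" unfolding m by (intro min.boundedI) simp_all
    then show ?thesis by (simp only: enat_ord_simps)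
  qed
  define h where "h = (harm ?m - 1 :: real)"
  have h1: "harm (card L) - 1 \<le> h" if "finite C" "card C \<le> k" "L \<subseteq> roots E C" for L C
    using card_le[OF that] unfolding h_def by (simp add: harm_mono)
  \<comment> \<open>A one-element cache, here of the arbitrary item \<open>undefined\<close>, has
    one root, and \<open>harm 1 = 1\<close>; it fits since \<open>k \<ge> 1\<close>.\<close>
  have h0: "0 \<le> h"
    using h1[of "{undefined}" "{undefined}"] assms(2) by (simp add: roots_def harm_expand)
  let ?s = "init_state E C0" and ?p = "bucketing_run E k C0 \<sigma>"
  have "finite C0" using assms(5) by (simp add: feasible_def)
  then have good: "good_state E k ?s"
    using assms(5) good_stateI[of ?s "roots E C0" "{}"]
    by (auto simp: init_state_def reset_buckets_roots)
  have pend: "pending (cache ?s) (pseudo_seq E \<sigma>)"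
    unfolding pending_def by (intro exI[of _ undefined] exI[of _ "[]"] exI[of _ \<sigma>]) simp
  have run: "?p = run (pseudo_seq E \<sigma>) ?s"
    by (simp add: bucketing_run_def foldl_bind_run bind_return_pmf)
  have "potential h i (pseudo_seq E \<sigma>) ?s = 0"
    by (simp add: potential_def evicted_charge_def init_state_def)
  then have *: "finite (set_pmf ?p)"
    "measure_pmf.expectation ?p (\<lambda>s. real (stale s i) - h * real (clean s i)) \<le> 0"
    using expectation_run[OF good pend _ h0, where i = i] h1 unfolding run by fastforce+
  \<comment> \<open>Integrability allows splitting the expectation in \<open>*(2)\<close>; the claim
    follows as \<open>1 + h = harm ?m\<close>.\<close>
  have "integrable ?p f" for f :: "'a bstate \<Rightarrow> real"
    using *(1) by (rule integrable_measure_pmf_finite)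
  then show ?thesis
    using *(2) by (simp add: h_def algebra_simps)
qed

end
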